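(* Let $G=(V,E)$ be a finite simple undirected graph and let $k>0$. Then for all positive integers $t_1,\dots,t_k$, \begin{align*}\chi_G^k(t_1,\dots,t_k)&=(t_1t_2\cdots t_k)^{c(G)}\,\chi^k_{M(G)}(t_k,t_{k-1},\dots,t_1)\\&=(-1)^{k\,\mathrm{rk}(G)}(t_1\cdots t_k)^{c(G)}\,T^k_{M(G)}(1-t_k,1-t_{k-1},\dots,1-t_1;\,0,\dots,0).\end{align*}
   Context: Graph notation: for $A\subseteq E$, $c(A)$ is the number of connected components of $(V,A)$, $c(G)=c(E)$, $\mathrm{rk}(A)=|V|-c(A)$, $\mathrm{rk}(G)=\mathrm{rk}(E)$, and $M(G)=(E,\mathrm{rk})$ is the graphic matroid. Coupled multicolorings: let $\mathcal{C}_1,\dots,\mathcal{C}_k$ be color sets. A $k$-multicoloring is a $k$-tuple $(f_1,\dots,f_k)$ of functions $f_i:V\to\mathcal{C}_i$. For $k>1$ it is a coupled $k$-multicoloring if for every edge $\{a,b\}\in E$: (i) for every even index $2m$ with $2\le 2m\le k$: if $f_i(a)=f_i(b)$ for all odd $i$ with $1\le i\le 2m-1$, then $f_{2m}(a)=f_{2m}(b)$; and (ii) if $k$ is odd, additionally: if $f_i(a)=f_i(b)$ for all odd $i$ with $1\le i\le k-2$, then $f_k(a)\ne f_k(b)$. For $k=1$, a coupled $1$-multicoloring is a proper vertex coloring ($f_1(a)\neq f_1(b)$ for every edge $\{a,b\}$). For positive integers $t_1,\dots,t_k$, $\chi_G^k(t_1,\dots,t_k)$ is the number of coupled $k$-multicolorings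 of $G$ with color sets of sizes $|\mathcal{C}_i|=t_i$. Matroid polynomials: for a matroid $M=(\mathcal{A},\mathrm{rk})$ with $\mathrm{rk}(M)=\mathrm{rk}(\mathcal{A})$, let $\mathcal{C}^k_{\mathcal{A}}=\{(A_1,\dots,A_k)\mid A_1\subseteq\cdots\subseteq A_k\subseteq\mathcal{A}\}$ (inclusions need not be strict). Then $\chi_M^k(t_1,\dots,t_k)=\sum_{(A_i)\in\mathcal{C}^k_{\mathcal{A}}}\prod_{i=1}^k(-1)^{|A_i|}t_i^{\mathrm{rk}(M)-\mathrm{rk}(A_i)}$ and $T^k_M(x_1,\dots,x_k;y_1,\dots,y_k)=\sum_{(A_i)\in\mathcal{C}^k_{\mathcal{A}}}\prod_{i=1}^k(x_i-1)^{\mathrm{rk}(M)-\mathrm{rk}(A_i)}(y_i-1)^{|A_i|-\mathrm{rk}(A_i)}$. *)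

theory Defs
  imports "HOL-Library.FuncSet"
begin

text \<open>
  A tuple $(x_1, \dots, x_k)$ is a function on \<^typ>\<open>nat\<close> of which only the values on
  \<open>{1..k}\<close> matter. Where tuples are counted or summed over, they are taken in \<^const>\<open>PiE\<close>,
  so that distinct functions are distinct tuples.
\<close>

locale matroid =
  fixes S :: "'e set" and r :: "'e set \<Rightarrow> nat"
  assumes finite_ground: "finite S"
    and rank_le_card: "X \<subseteq> S \<Longrightarrow> r X \<le> card X"
    and rank_mono: "X \<subseteq> Y \<Longrightarrow> Y \<subseteq> S \<Longrightarrow> r X \<le> r Y"
    and rank_submodular: "X \<subseteq> S \<Longrightarrow> Y \<subseteq> S \<Longrightarrow> r (X \<union> Y) + r (X \<inter> Y) \<le> r X + r Y"
begin

definition chains :: "nat \<Rightarrow> (nat \<Rightarrow> 'e set) set" where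
  "chains k = {A \<in> {1..k} \<rightarrow>\<^sub>E Pow S. \<forall>i\<in>{1..k}. \<forall>j\<in>{1..k}. i \<le> j \<longrightarrow> A i \<subseteq> A j}"

text \<open>
  The subtractions in the exponents never truncate, by \<open>rank_mono\<close> and \<open>rank_le_card\<close>.
\<close>

definition char_poly :: "nat \<Rightarrow> (nat \<Rightarrow> 'a::comm_ring_1) \<Rightarrow> 'a" where
  "char_poly k t = (\<Sum>A\<in>chains k. \<Prod>i=1..k. (- 1) ^ card (A i) * t i ^ (r S - r (A i)))"

definition tutte_poly :: "nat \<Rightarrow> (nat \<Rightarrow> 'a::comm_ring_1) \<Rightarrow> (nat \<Rightarrow> 'a) \<Rightarrow> 'a" where
  "tutte_poly k x y = (\<Sum>A\<in>chains k. \<Prod>i=1..k.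
     (x i - 1) ^ (r S - r (A i)) * (y i - 1) ^ (card (A i) - r (A i)))"

end

locale simple_graph =
  fixes V :: "'v set" and E :: "'v set set"
  assumes finite_V: "finite V"
    and edge_subset: "e \<in> E \<Longrightarrow> e \<subseteq> V"
    and edge_card: "e \<in> E \<Longrightarrow> card e = 2"
begin

definition connected_rel :: "'v set set \<Rightarrow> ('v \<times> 'v) set" where
  "connected_rel A = {(u, v). {u, v} \<in> A}\<^sup>* \<inter> V \<times> V"

definition num_components :: "'v set set \<Rightarrow> nat" where
  "num_components A = card (V // connected_rel A)"

definition rk :: "'v set set \<Rightarrow> nat" where
  "rk A = card V - num_components A"

definition coupled_multicolorings :: "nat \<Rightarrow> (nat \<Rightarrow> 'c set) \<Rightarrow> (nat \<Rightarrow> 'v \<Rightarrow> 'c) set" where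
  "coupled_multicolorings k C =
    {f \<in> (\<Pi>\<^sub>E i\<in>{1..k}. V \<rightarrow>\<^sub>E C i). \<forall>a b. {a, b} \<in> E \<longrightarrow>
       (if k = 1 then f 1 a \<noteq> f 1 b
        else
          (\<forall>m. 2 \<le> 2 * m \<and> 2 * m \<le> k \<longrightarrow>
             (\<forall>i. odd i \<and> 1 \<le> i \<and> i \<le> 2 * m - 1 \<longrightarrow> f i a = f i b) \<longrightarrow> f (2 * m) a = f (2 * m) b) \<and>
          (odd k \<longrightarrow>
             (\<forall>i. odd i \<and> 1 \<le> i \<and> i \<le> k - 2 \<longrightarrow> f i a = f i b) \<longrightarrow> f k a \<noteq> f k b))}"

definition num_coupled_multicolorings :: "nat \<Rightarrow> (nat \<Rightarrow> 'c set) \<Rightarrow> nat" where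
  "num_coupled_multicolorings k C = card (coupled_multicolorings k C)"

lemma finite_E: "finite E"
  using finite_V edge_subset by (meson PowI finite_Pow_iff finite_subset subsetI)

lemma equiv_connected_rel: "equiv V (connected_rel A)"
proof -
  have "sym {(u, v). {u, v} \<in> A}"
    by (auto simp: sym_def insert_commute)
  then have "sym ({(u, v). {u, v} \<in> A}\<^sup>*)" by (rule sym_rtrancl)
  then show ?thesis
    unfolding connected_rel_def equiv_def refl_on_def sym_def trans_def
    by (auto intro: rtrancl_trans)
qed

lemma num_components_le: "num_components A \<le> card V"
  unfolding num_components_def quotient_def
  using finite_V by (simp add: UNION_singleton_eq_range card_image_le)

lemma rk_plus_num_components: "rk A + num_components A = card V"
  using num_components_le[of A] by (simp add: rk_def)

lemma connected_rel_insert: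
  assumes "{a, b} \<in> E"
  shows "connected_rel (insert {a, b} A) = connected_rel A \<union>
    {(x, y). (x, a) \<in> connected_rel A \<and> (b, y) \<in> connected_rel A} \<union>
    {(x, y). (x, b) \<in> connected_rel A \<and> (a, y) \<in> connected_rel A}"
proof -
  have ab: "a \<in> V" "b \<in> V" using edge_subset[OF assms] by auto
  have eq: "{(u, v). {u, v} \<in> insert {a, b} A} = insert (a, b) (insert (b, a) {(u, v). {u, v} \<in> A})"
    by (auto simp: doubleton_eq_iff)
  have inV: "(x, y) \<in> {(u, v). {u, v} \<in> A}\<^sup>* \<inter> V \<times> V \<longleftrightarrow>
     (x, y) \<in> {(u, v). {u, v} \<in> A}\<^sup>* \<and> x \<in> V \<and> y \<in> V" for x y by auto
  show ?thesis
    unfolding connected_rel_def eq rtrancl_insert using ab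
    by (auto intro: rtrancl_trans)
qed

lemma num_components_insert:
  assumes e: "{a, b} \<in> E"
  shows "num_components A =
    num_components (insert {a, b} A) + (if (a, b) \<in> connected_rel A then 0 else 1)"
proof -
  let ?R = "connected_rel A"
  let ?R' = "connected_rel (insert {a, b} A)"
  have ab: "a \<in> V" "b \<in> V" using edge_subset[OF e] by auto
  have eq: "equiv V ?R" and eq': "equiv V ?R'" by (rule equiv_connected_rel)+
  have s: "(x, y) \<in> ?R \<Longrightarrow> (y, x) \<in> ?R" for x y using eq by (meson equivE symD)
  have t: "(x, y) \<in> ?R \<Longrightarrow> (y, z) \<in> ?R \<Longrightarrow> (x, z) \<in> ?R" for x y z
    using eq by (meson equivE transD)
  have rf: "x \<in> V \<Longrightarrow> (x, x) \<in> ?R" for x using eq by (meson equivE refl_onD)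
  note ins = connected_rel_insert[OF e, of A]
  show ?thesis
  proof (cases "(a, b) \<in> ?R")
    case True
    have "(x, y) \<in> ?R" if "(x, a) \<in> ?R" "(b, y) \<in> ?R" for x y
      using t[OF t[OF that(1) True] that(2)] .
    moreover have "(x, y) \<in> ?R" if "(x, b) \<in> ?R" "(a, y) \<in> ?R" for x y
      using t[OF t[OF that(1) s[OF True]] that(2)] .
    ultimately have "?R' = ?R" unfolding ins by blast
    then show ?thesis using True by (simp add: num_components_def)
  next
    case False
    let ?a = "?R `` {a}" and ?b = "?R `` {b}"
    have neq: "?a \<noteq> ?b" using False rf[OF ab(2)] by auto
    have cls: "?R `` {x} = ?R `` {z}" if "x \<in> ?R `` {z}" for x z
      using equiv_class_eq[OF eq] that by blast
    have im: "?R' `` {x} = ?R `` {x} \<union> (if x \<in> ?a then ?b else {}) \<union> (if x \<in> ?b then ?a else {})" for x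
    proof -
      have "(x, z) \<in> ?R \<longleftrightarrow> (z, x) \<in> ?R" for z using s by blast
      then show ?thesis unfolding ins by (auto split: if_splits)
    qed
    have imab: "?R' `` {x} = ?a \<union> ?b" if "x \<in> ?a \<union> ?b" for x
    proof (cases "x \<in> ?a")
      case True then show ?thesis using cls[OF True] by (auto simp: im)
    next
      case False
      then have "x \<in> ?b" using that by simp
      with False show ?thesis using cls[OF \<open>x \<in> ?b\<close>] by (auto simp: im)
    qed
    have imo: "?R' `` {x} = ?R `` {x}" if "x \<notin> ?a \<union> ?b" for x
      using that by (simp add: im)
    have fin: "finite (V // ?R)"
      using finite_V by (simp add: quotient_def)
    have mem: "?a \<in> V // ?R" "?b \<in> V // ?R" using ab by (auto simp: quotient_def)
    have quot: "V // ?R' = insert (?a \<union> ?b) (V // ?R - {?a, ?b})"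
    proof (intro set_eqI iffI)
      fix X assume "X \<in> V // ?R'"
      then obtain x where x: "x \<in> V" "X = ?R' `` {x}" by (auto simp: quotient_def)
      show "X \<in> insert (?a \<union> ?b) (V // ?R - {?a, ?b})"
      proof (cases "x \<in> ?a \<union> ?b")
        case True then show ?thesis using x imab by simp
      next
        case False
        have "x \<in> ?R `` {x}" using rf[OF x(1)] by auto
        then have "?R `` {x} \<noteq> ?a" "?R `` {x} \<noteq> ?b" using False by auto
        then show ?thesis using x imo[OF False] by (auto simp: quotient_def)
      qed
    next
      fix X assume "X \<in> insert (?a \<union> ?b) (V // ?R - {?a, ?b})"
      then consider "X = ?a \<union> ?b" | "X \<in> V // ?R" "X \<noteq> ?a" "X \<noteq> ?b" by auto
      then show "X \<in> V // ?R'"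
      proof cases
        case 1
        have "?R' `` {a} = X" using imab[of a] rf[OF ab(1)] 1 by auto
        then show ?thesis using ab(1) by (auto simp: quotient_def)
      next
        case 2
        then obtain x where x: "x \<in> V" "X = ?R `` {x}" by (auto simp: quotient_def)
        have "x \<notin> ?a \<union> ?b" using 2 x cls[of x a] cls[of x b] by auto
        then have "X = ?R' `` {x}" using imo x by simp
        then show ?thesis using x(1) by (auto simp: quotient_def)
      qed
    qed
    have notin: "?a \<union> ?b \<notin> V // ?R - {?a, ?b}"
    proof
      assume "?a \<union> ?b \<in> V // ?R - {?a, ?b}"
      then obtain x where x: "?a \<union> ?b = ?R `` {x}" "?a \<union> ?b \<noteq> ?a" by (auto simp: quotient_def)
      then have "(x, a) \<in> ?R" "(x, b) \<in> ?R" using rf ab by blast+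
      then show False using False s t by blast
    qed
    have "card (V // ?R') = Suc (card (V // ?R - {?a, ?b}))"
      unfolding quot using notin fin by simp
    also have "card (V // ?R - {?a, ?b}) = card (V // ?R) - 2"
      using mem neq fin by (simp add: card_Diff_subset)
    finally have "card (V // ?R') = Suc (card (V // ?R) - 2)" .
    moreover have "card (V // ?R) \<ge> 2"
      using card_mono[OF fin, of "{?a, ?b}"] mem neq by simp
    ultimately show ?thesis using False by (simp add: num_components_def)
  qed
qed

lemma rk_insert:
  assumes "{a, b} \<in> E"
  shows "rk (insert {a, b} A) = rk A + (if (a, b) \<in> connected_rel A then 0 else 1)"
  using num_components_insert[OF assms, of A] rk_plus_num_components[of A]
    rk_plus_num_components[of "insert {a, b} A"] by auto

lemma edge_doubleton:
  assumes "e \<in> E"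
  obtains a b where "e = {a, b}"
  using edge_card[OF assms] by (auto simp: card_2_iff)

lemma rk_empty: "rk {} = 0"
proof -
  have "connected_rel {} = Id_on V" by (auto simp: connected_rel_def)
  then have "V // connected_rel {} = (\<lambda>x. {x}) ` V"
    by (auto simp: quotient_def Id_on_def)
  then show ?thesis by (simp add: rk_def num_components_def card_image)
qed

lemma rk_insert_step:
  assumes "e \<in> E" "X \<subseteq> Y"
  shows "rk (insert e Y) + rk X \<le> rk Y + rk (insert e X)"
proof -
  obtain a b where e: "e = {a, b}" using assms(1) by (rule edge_doubleton)
  have "{(u, v). {u, v} \<in> X}\<^sup>* \<subseteq> {(u, v). {u, v} \<in> Y}\<^sup>*"
    using assms(2) by (intro rtrancl_mono) auto
  then have "connected_rel X \<subseteq> connected_rel Y"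
    by (auto simp: connected_rel_def)
  then show ?thesis using rk_insert[of a b X] rk_insert[of a b Y] assms(1) unfolding e by auto
qed

lemma rk_Un_step:
  assumes "D \<subseteq> E" "X \<subseteq> Y"
  shows "rk (Y \<union> D) + rk X \<le> rk Y + rk (X \<union> D)"
proof -
  have "finite D" using assms(1) finite_E finite_subset by blast
  then show ?thesis using assms(1)
  proof (induction D rule: finite_induct)
    case (insert e D)
    have "X \<union> D \<subseteq> Y \<union> D" using assms(2) by blast
    with insert show ?case using rk_insert_step[of e "X \<union> D" "Y \<union> D"] by simp
  qed simp
qed

end

text \<open>
  The graphic matroid \<open>M(G)\<close> is the matroid \<open>(E, rk)\<close>.
\<close>

sublocale simple_graph \<subseteq> graphic: matroid E rk
proof
  show "finite E" by (rule finite_E)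
next
  fix X assume "X \<subseteq> E"
  then have "finite X" using finite_E finite_subset by blast
  then show "rk X \<le> card X" using \<open>X \<subseteq> E\<close>
  proof (induction X rule: finite_induct)
    case (insert e X)
    obtain a b where e: "e = {a, b}" using insert.prems by (auto elim: edge_doubleton)
    then show ?case using insert rk_insert[of a b X] by auto
  qed (simp add: rk_empty)
next
  fix X Y assume "X \<subseteq> Y" "Y \<subseteq> E"
  then show "rk X \<le> rk Y"
  proof -
    have "finite (Y - X)" using \<open>Y \<subseteq> E\<close> finite_E by (meson finite_Diff finite_subset)
    moreover have "rk X \<le> rk (X \<union> D)" if "finite D" "D \<subseteq> E" for D
      using that
    proof (induction D rule: finite_induct)
      case (insert e D)
      obtain a b where e: "e = {a, b}" using insert.prems by (auto elim: edge_doubleton)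
      then show ?case using insert rk_insert[of a b "X \<union> D"] by auto
    qed simp
    ultimately have "rk X \<le> rk (X \<union> (Y - X))" using \<open>Y \<subseteq> E\<close> by blast
    then show ?thesis using \<open>X \<subseteq> Y\<close> by (simp add: Un_absorb1)
  qed
next
  fix X Y assume "X \<subseteq> E" "Y \<subseteq> E"
  then show "rk (X \<union> Y) + rk (X \<inter> Y) \<le> rk X + rk Y"
    using rk_Un_step[of Y "X \<inter> Y" X] by (simp add: Un_absorb1)
qed

end

theory Submission
  imports Defs
begin

text \<open>
  Reverse the chain, so that \<open>B\<^sub>i = A\<^bsub>k+1-i\<^esub>\<close> decreases. Then \<open>t\<^sub>i\<close> to the power \<open>c(B\<^sub>i)\<close> counts
  the \<open>f\<^sub>i\<close> that are constant on the edges in \<open>B\<^sub>i\<close>, and the right-hand side becomes a signed count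
  of pairs of a multicolouring and a chain of monochromatic edge sets. For a fixed multicolouring
  the sum over the chains factorises over the edges. An edge lies in \<open>B\<^sub>1, \<dots>, B\<^sub>j\<close> only, for some
  \<open>j\<close>, so its factor is \<open>1 - 1 + 1 - \<dots> \<plusminus> 1\<close> with \<open>J + 1\<close> terms, where \<open>f\<^sub>1, \<dots>, f\<^sub>J\<close> is the
  longest initial segment of colourings that are monochromatic on the edge. This is \<open>1\<close> if \<open>J\<close> is
  even and \<open>0\<close> if \<open>J\<close> is odd, and the coupling condition says precisely that \<open>J\<close> is even.
\<close>

section \<open>Sums over chains of subsets\<close>

text \<open>The ground set is an argument because the recursion on \<open>k\<close> changes it: once
  the largest member of a chain is split off, that member is the ground set of the rest. The rank
  plays no part here.\<close>

definition subset_chains :: "nat \<Rightarrow> 'e set \<Rightarrow> (nat \<Rightarrow> 'e set) set" where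
  "subset_chains k S = {A \<in> {1..k} \<rightarrow>\<^sub>E Pow S. \<forall>i\<in>{1..k}. \<forall>j\<in>{1..k}. i \<le> j \<longrightarrow> A i \<subseteq> A j}"

lemma finite_subset_chains: "finite S \<Longrightarrow> finite (subset_chains k S)"
  by (simp add: subset_chains_def finite_PiE)

lemma bij_betw_subset_chains_Suc:
  "bij_betw (\<lambda>(B, A). A(Suc k := B)) (Sigma (Pow S) (subset_chains k)) (subset_chains (Suc k) S)"
proof (rule bij_betw_byWitness[where f' = "\<lambda>A. (A (Suc k), A(Suc k := undefined))"], goal_cases)
  case 1
  then show ?case
    by (auto simp: subset_chains_def PiE_def extensional_def fun_eq_iff)
next
  case 2
  then show ?case by simp
next
  case 3
  show ?case
    by (fastforce simp: subset_chains_def PiE_iff extensional_def le_Suc_eq)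
next
  case 4
  show ?case
    by (auto simp: subset_chains_def PiE_iff extensional_def)
qed

text \<open>A chain amounts to an independent choice, for each \<open>e\<close>, of the number
  \<open>j\<close> of members that miss \<open>e\<close>; then \<open>e\<close> lies in
  \<open>A i\<close> exactly for \<open>i > j\<close>. The formal proof reaches this factorisation
  by splitting off the largest member \<open>B\<close>.\<close>

lemma sum_subset_chains:
  fixes g :: "nat \<Rightarrow> 'e \<Rightarrow> 'a::comm_semiring_1"
  assumes "finite S"
  shows "(\<Sum>A\<in>subset_chains k S. \<Prod>i=1..k. \<Prod>e\<in>A i. g i e) = (\<Prod>e\<in>S. \<Sum>j\<le>k. \<Prod>i\<in>{j<..k}. g i e)"
  using assms
proof (induction k arbitrary: S)
  case 0
  have "subset_chains 0 S = {\<lambda>_. undefined}"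
    by (auto simp: subset_chains_def)
  then show ?case by simp
next
  case (Suc k)
  \<comment> \<open>The summand 1 is the empty product at \<open>j = Suc k\<close>, the case of an
    element outside the largest member.\<close>
  have w: "(\<Sum>j\<le>Suc k. \<Prod>i\<in>{j<..Suc k}. g i e) =
      g (Suc k) e * (\<Sum>j\<le>k. \<Prod>i\<in>{j<..k}. g i e) + 1" for e
  proof -
    have "{j<..Suc k} = insert (Suc k) {j<..k}" if "j \<le> k" for j
      using that by auto
    then have "(\<Sum>j\<le>k. \<Prod>i\<in>{j<..Suc k}. g i e) = (\<Sum>j\<le>k. g (Suc k) e * (\<Prod>i\<in>{j<..k}. g i e))"
      by (intro sum.cong) auto
    then show ?thesis by (simp add: sum_distrib_left)
  qed
  have "(\<Sum>A\<in>subset_chains (Suc k) S. \<Prod>i=1..Suc k. \<Prod>e\<in>A i. g i e) =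
      (\<Sum>(B, A)\<in>Sigma (Pow S) (subset_chains k).
        \<Prod>i=1..Suc k. \<Prod>e\<in>(A(Suc k := B)) i. g i e)"
    by (subst sum.reindex_bij_betw[OF bij_betw_subset_chains_Suc, symmetric])
      (simp add: case_prod_unfold)
  also have "\<dots> = (\<Sum>B\<in>Pow S. \<Sum>A\<in>subset_chains k B.
        \<Prod>i=1..Suc k. \<Prod>e\<in>(A(Suc k := B)) i. g i e)"
    using Suc.prems finite_subset
    by (subst sum.Sigma) (auto intro!: finite_subset_chains)
  also have "\<dots> = (\<Sum>B\<in>Pow S. (\<Prod>e\<in>B. g (Suc k) e) *
        (\<Sum>A\<in>subset_chains k B. \<Prod>i=1..k. \<Prod>e\<in>A i. g i e))"
  proof (intro sum.cong refl, unfold sum_distrib_left, intro sum.cong refl)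
    fix B A
    have "(\<Prod>i=1..k. \<Prod>e\<in>(A(Suc k := B)) i. g i e) = (\<Prod>i=1..k. \<Prod>e\<in>A i. g i e)"
      by (intro prod.cong) auto
    then show "(\<Prod>i=1..Suc k. \<Prod>e\<in>(A(Suc k := B)) i. g i e) =
        (\<Prod>e\<in>B. g (Suc k) e) * (\<Prod>i=1..k. \<Prod>e\<in>A i. g i e)"
      by (simp add: mult.commute)
  qed
  also have "\<dots> = (\<Sum>B\<in>Pow S. \<Prod>e\<in>B. g (Suc k) e * (\<Sum>j\<le>k. \<Prod>i\<in>{j<..k}. g i e))"
    using Suc.prems by (intro sum.cong refl) (simp add: Suc.IH finite_subset prod.distrib del: One_nat_def)
  \<comment> \<open>Read backwards: multiplying out factors of the form \<open>u + 1\<close> over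
    \<open>S\<close> gives one term for each subset \<open>B\<close>, the set of elements where
    \<open>u\<close> is taken.\<close>
  also have "\<dots> = (\<Prod>e\<in>S. \<Sum>j\<le>Suc k. \<Prod>i\<in>{j<..Suc k}. g i e)"
    unfolding w using Suc.prems by (subst prod_add) simp_all
  finally show ?case .
qed

section \<open>The coupling condition at a single edge\<close>

text \<open>
  For \<open>k = 1\<close> the premise of the last clause is vacuous because \<open>k - 2\<close> truncates to \<open>0\<close>, so
  \<open>coupled 1 P\<close> is \<open>\<not> P 1\<close> and no separate case is needed.
\<close>

definition coupled :: "nat \<Rightarrow> (nat \<Rightarrow> bool) \<Rightarrow> bool" where
  "coupled k P \<longleftrightarrow>
    (\<forall>m. 2 \<le> 2 * m \<and> 2 * m \<le> k \<longrightarrow> (\<forall>i. odd i \<and> 1 \<le> i \<and> i \<le> 2 * m - 1 \<longrightarrow> P i) \<longrightarrow> P (2 * m)) \<and>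
    (odd k \<longrightarrow> (\<forall>i. odd i \<and> 1 \<le> i \<and> i \<le> k - 2 \<longrightarrow> P i) \<longrightarrow> \<not> P k)"

text \<open>Each even index is forced by the odd ones below it. The premises on odd indices thereby
  become statements about initial segments.\<close>

lemma coupled_even_agree_iff:
  assumes "coupled (2 * m) P"
  shows "(\<forall>i. odd i \<and> 1 \<le> i \<and> i \<le> 2 * m - 1 \<longrightarrow> P i) \<longleftrightarrow> (\<forall>i\<in>{1..2 * m}. P i)"
proof (intro iffI ballI)
  fix i assume *: "\<forall>i. odd i \<and> 1 \<le> i \<and> i \<le> 2 * m - 1 \<longrightarrow> P i" and i: "i \<in> {1..2 * m}"
  show "P i"
  proof (cases "even i")
    case True
    then obtain l where l: "i = 2 * l" by blast
    with i have "2 \<le> 2 * l" "2 * l \<le> 2 * m" by auto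
    moreover from this have "\<forall>i. odd i \<and> 1 \<le> i \<and> i \<le> 2 * l - 1 \<longrightarrow> P i"
      using * by auto
    ultimately show ?thesis
      using assms unfolding coupled_def l by blast
  next
    case False
    then have "1 \<le> i" "i \<le> 2 * m - 1" using i by (auto, presburger)
    with False * show ?thesis by blast
  qed
qed auto

text \<open>No even index is added between \<open>2 * m\<close> and \<open>2 * m + 1\<close>, so
  only the clause for odd \<open>k\<close> is new, and its premise ranges over the odd indices up to
  \<open>2 * m - 1\<close>.\<close>

lemma coupled_odd_iff:
  "coupled (2 * m + 1) P \<longleftrightarrow> coupled (2 * m) P \<and> \<not> (\<forall>i\<in>{1..2 * m + 1}. P i)"
proof -
  have "2 * l \<le> 2 * m + 1 \<longleftrightarrow> 2 * l \<le> 2 * m" for l by presburger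
  then have "coupled (2 * m + 1) P \<longleftrightarrow> coupled (2 * m) P \<and>
      \<not> ((\<forall>i. odd i \<and> 1 \<le> i \<and> i \<le> 2 * m - 1 \<longrightarrow> P i) \<and> P (2 * m + 1))"
    unfolding coupled_def by auto
  also have "\<dots> \<longleftrightarrow> coupled (2 * m) P \<and> \<not> ((\<forall>i\<in>{1..2 * m}. P i) \<and> P (2 * m + 1))"
    using coupled_even_agree_iff by blast
  also have "(\<forall>i\<in>{1..2 * m}. P i) \<and> P (2 * m + 1) \<longleftrightarrow> (\<forall>i\<in>{1..2 * m + 1}. P i)"
    by (simp add: atLeastAtMostSuc_conv conj_commute)
  finally show ?thesis .
qed

lemma coupled_even_iff:
  "coupled (2 * m + 2) P \<longleftrightarrow>
    coupled (2 * m) P \<and> ((\<forall>i\<in>{1..2 * m + 1}. P i) \<longrightarrow> P (2 * m + 2))"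
proof -
  let ?O = "\<lambda>n. \<forall>i. odd i \<and> 1 \<le> i \<and> i \<le> n \<longrightarrow> P i"
  have le: "2 \<le> 2 * l \<and> 2 * l \<le> 2 * m + 2 \<longleftrightarrow> 2 \<le> 2 * l \<and> 2 * l \<le> 2 * m \<or> l = m + 1" for l
    by presburger
  have "odd i \<and> 1 \<le> i \<and> i \<le> 2 * m + 1 \<longleftrightarrow> odd i \<and> 1 \<le> i \<and> i \<le> 2 * m - 1 \<or> i = 2 * m + 1" for i
    by presburger
  then have O: "?O (2 * m + 1) \<longleftrightarrow> ?O (2 * m - 1) \<and> P (2 * m + 1)"
    by blast
  have "coupled (2 * m + 2) P \<longleftrightarrow> coupled (2 * m) P \<and> (?O (2 * m + 1) \<longrightarrow> P (2 * m + 2))"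
    unfolding coupled_def le by (auto simp: all_conj_distrib)
  also have "\<dots> \<longleftrightarrow> coupled (2 * m) P \<and>
      ((\<forall>i\<in>{1..2 * m}. P i) \<and> P (2 * m + 1) \<longrightarrow> P (2 * m + 2))"
    using coupled_even_agree_iff unfolding O by blast
  also have "(\<forall>i\<in>{1..2 * m}. P i) \<and> P (2 * m + 1) \<longleftrightarrow> (\<forall>i\<in>{1..2 * m + 1}. P i)"
    by (simp add: atLeastAtMostSuc_conv conj_commute)
  finally show ?thesis .
qed

text \<open>The summand for \<open>j\<close> is \<open>(- 1) ^ j\<close> as long as \<open>P\<close>
  holds on \<open>{1..j}\<close>, and 0 afterwards. The alternating sum is followed two terms at a
  time through the even \<open>k\<close>; an odd \<open>k\<close> takes one term more.\<close>

lemma of_bool_coupled: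
  "of_bool (coupled k P) = (\<Sum>j\<le>k. \<Prod>i=1..j. - of_bool (P i) :: 'a::comm_ring_1)"
proof -
  define Q where "Q j \<longleftrightarrow> (\<forall>i\<in>{1..j}. P i)" for j
  have q: "(\<Prod>i=1..j. - of_bool (P i) :: 'a) = (- 1) ^ j * of_bool (Q j)" for j
    by (induction j) (auto simp: Q_def atLeastAtMostSuc_conv)
  \<comment> \<open>This inclusion is what lets the indicator of a difference be the difference of
    the indicators.\<close>
  have Q_coupled: "Q (2 * m + 1) \<Longrightarrow> coupled (2 * m) P" for m
    by (auto simp: Q_def coupled_def)
  have even: "of_bool (coupled (2 * m) P) = (\<Sum>j\<le>2 * m. (- 1) ^ j * of_bool (Q j) :: 'a)" for m
  proof (induction m)
    case 0
    then show ?case by (simp add: coupled_def Q_def)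
  next
    case (Suc m)
    have "Q (2 * m + 2) \<longleftrightarrow> Q (2 * m + 1) \<and> P (2 * m + 2)"
      by (auto simp: Q_def atLeastAtMostSuc_conv)
    moreover have "coupled (2 * m + 2) P \<longleftrightarrow> coupled (2 * m) P \<and> (Q (2 * m + 1) \<longrightarrow> P (2 * m + 2))"
      unfolding Q_def by (rule coupled_even_iff)
    ultimately have "of_bool (coupled (2 * m + 2) P) =
        (of_bool (coupled (2 * m) P) - of_bool (Q (2 * m + 1)) + of_bool (Q (2 * m + 2)) :: 'a)"
      using Q_coupled[of m] by (auto simp: of_bool_def)
    then show ?case using Suc by simp
  qed
  show ?thesis
  proof (cases "even k")
    case True
    then show ?thesis unfolding q using even by blast
  next
    case False
    then obtain m where k: "k = 2 * m + 1" by (rule oddE)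
    have "coupled (2 * m + 1) P \<longleftrightarrow> coupled (2 * m) P \<and> \<not> Q (2 * m + 1)"
      unfolding Q_def by (rule coupled_odd_iff)
    then have "of_bool (coupled k P) =
        (of_bool (coupled (2 * m) P) - of_bool (Q (2 * m + 1)) :: 'a)"
      using Q_coupled[of m] by (auto simp: k of_bool_def)
    then show ?thesis unfolding q by (simp add: k even)
  qed
qed

section \<open>Indicator products and reversal of indices\<close>

lemma prod_of_bool:
  assumes "finite A"
  shows "(\<Prod>x\<in>A. of_bool (P x) :: 'a::comm_semiring_1) = of_bool (\<forall>x\<in>A. P x)"
  using assms by (induction A rule: finite_induct) auto

text \<open>An element of an increasing chain belongs to its last members, whereas coupling reads
  the colourings from the first. This matches the two orders.\<close>

lemma sum_prod_rev_eq:
  fixes f :: "nat \<Rightarrow> 'a::comm_semiring_1"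
  shows "(\<Sum>j\<le>k. \<Prod>i\<in>{j<..k}. f (k + 1 - i)) = (\<Sum>j\<le>k. \<Prod>i=1..j. f i)"
proof -
  have "(\<Prod>i\<in>{k - j<..k}. f (k + 1 - i)) = (\<Prod>i=1..j. f i)" if "j \<le> k" for j
    using that
    by (intro prod.reindex_bij_witness[where i = "\<lambda>i. k + 1 - i" and j = "\<lambda>i. k + 1 - i"]) auto
  then have "(\<Sum>j\<le>k. \<Prod>i=1..j. f i) = (\<Sum>j\<le>k. \<Prod>i\<in>{k - j<..k}. f (k + 1 - i))"
    by simp
  also have "\<dots> = (\<Sum>j\<le>k. \<Prod>i\<in>{j<..k}. f (k + 1 - i))"
    by (intro sum.reindex_bij_witness[where i = "\<lambda>j. k - j" and j = "\<lambda>j. k - j"]) auto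
  finally show ?thesis by simp
qed

section \<open>Functions constant on equivalence classes\<close>

lemma card_class_functions:
  assumes "finite V" "equiv V R"
  shows "card {f \<in> V \<rightarrow>\<^sub>E C. \<forall>(x, y)\<in>R. f x = f y} = card C ^ card (V // R)"
proof -
  let ?F = "{f \<in> V \<rightarrow>\<^sub>E C. \<forall>(x, y)\<in>R. f x = f y}"
  have repr: "\<exists>x. x \<in> X \<and> x \<in> V \<and> X = R `` {x}" if "X \<in> V // R" for X
    using that assms(2) by (metis equiv_class_self quotientE)
  define s where "s X = (SOME x. x \<in> X \<and> x \<in> V \<and> X = R `` {x})" for X
  have s: "s X \<in> X" "s X \<in> V" "R `` {s X} = X" if "X \<in> V // R" for X
    using someI_ex[OF repr[OF that]] by (auto simp: s_def)
  have sR: "(x, s (R `` {x})) \<in> R" if "x \<in> V" for x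
    using s(1)[OF quotientI[OF that]] by blast
  \<comment> \<open>Pulling back along the quotient map is inverted by evaluating at the chosen
    representatives \<open>s X\<close>.\<close>
  have "bij_betw (\<lambda>g. \<lambda>x\<in>V. g (R `` {x})) ((V // R) \<rightarrow>\<^sub>E C) ?F"
  proof (rule bij_betw_byWitness[where f' = "\<lambda>f. \<lambda>X\<in>V // R. f (s X)"], goal_cases)
    case 1
    show ?case using s by (auto simp: fun_eq_iff restrict_def PiE_iff extensional_def)
  next
    case 2
    show ?case
    proof (intro ballI ext)
      fix f x assume f: "f \<in> ?F"
      have "f x = f (s (R `` {x}))" if "x \<in> V"
        using f sR[OF that] by blast
      moreover have "f x = undefined" if "x \<notin> V"
        using f that by (auto simp: PiE_iff extensional_def)
      ultimately show "(\<lambda>x\<in>V. (\<lambda>X\<in>V // R. f (s X)) (R `` {x})) x = f x"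
        by (simp add: quotientI)
    qed
  next
    case 3
    show ?case
    proof (rule image_subsetI)
      fix g assume "g \<in> (V // R) \<rightarrow>\<^sub>E C"
      then show "(\<lambda>x\<in>V. g (R `` {x})) \<in> ?F"
        using equiv_class_eq_iff[OF assms(2)] by (auto simp: PiE_iff quotientI)
    qed
  next
    case 4
    show ?case using s(2) by auto
  qed
  moreover have "finite (V // R)"
    using assms(1) by (simp add: quotient_def)
  ultimately show ?thesis
    by (simp add: bij_betw_same_card[symmetric] card_funcsetE)
qed

section \<open>Counting coupled multicolorings of a graph\<close>

context simple_graph
begin

text \<open>Equality of colours propagates along paths, so constancy on the edges of
  \<open>A\<close> is constancy on the components of \<open>(V, A)\<close>.\<close>

lemma num_edgewise_constant:
  fixes C :: "'c set"
  assumes "A \<subseteq> E"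
  shows "card {f \<in> V \<rightarrow>\<^sub>E C. \<forall>e\<in>A. \<forall>a\<in>e. \<forall>b\<in>e. f a = f b} = card C ^ num_components A"
proof -
  have "(\<forall>e\<in>A. \<forall>a\<in>e. \<forall>b\<in>e. f a = f b) \<longleftrightarrow> (\<forall>(x, y)\<in>connected_rel A. f x = f y)" for f :: "'v \<Rightarrow> 'c"
  proof
    assume L: "\<forall>e\<in>A. \<forall>a\<in>e. \<forall>b\<in>e. f a = f b"
    have "f x = f y" if "(x, y) \<in> {(u, v). {u, v} \<in> A}\<^sup>*" for x y
      using that
    proof (induction rule: rtrancl_induct)
      case (step y z)
      then have "{y, z} \<in> A" by simp
      with L have "f y = f z" by auto
      with step.IH show ?case by simp
    qed simp
    then show "\<forall>(x, y)\<in>connected_rel A. f x = f y"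
      by (auto simp: connected_rel_def)
  next
    assume R: "\<forall>(x, y)\<in>connected_rel A. f x = f y"
    show "\<forall>e\<in>A. \<forall>a\<in>e. \<forall>b\<in>e. f a = f b"
    proof (intro ballI)
      fix e a b assume e: "e \<in> A" "a \<in> e" "b \<in> e"
      show "f a = f b"
      proof (cases "a = b")
        case False
        have "e \<in> E" using e assms by blast
        then have "e = {a, b}" using e False by (elim edge_doubleton) auto
        moreover have "a \<in> V" "b \<in> V" using \<open>e \<in> E\<close> e edge_subset by blast+
        ultimately have "(a, b) \<in> connected_rel A"
          using e by (auto simp: connected_rel_def)
        then show ?thesis using R by blast
      qed simp
    qed
  qed
  then show ?thesis
    using card_class_functions[OF finite_V equiv_connected_rel, of C A]
    by (simp add: num_components_def)
qed

lemma chains_eq_subset_chains: "graphic.chains k = subset_chains k E"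
  by (simp add: graphic.chains_def subset_chains_def)

text \<open>Only whether each \<open>f i\<close> is monochromatic on the edge matters, not the order
  of its ends. With one condition per edge, the indicator of coupling is a product over
  \<open>E\<close>.\<close>

lemma coupled_multicolorings_eq:
  fixes C :: "nat \<Rightarrow> 'c set"
  shows "coupled_multicolorings k C = {f \<in> (\<Pi>\<^sub>E i\<in>{1..k}. V \<rightarrow>\<^sub>E C i).
    \<forall>e\<in>E. coupled k (\<lambda>i. \<forall>a\<in>e. \<forall>b\<in>e. f i a = f i b)}"
proof -
  have c: "(if k = 1 then \<not> P 1 else
          (\<forall>m. 2 \<le> 2 * m \<and> 2 * m \<le> k \<longrightarrow>
             (\<forall>i. odd i \<and> 1 \<le> i \<and> i \<le> 2 * m - 1 \<longrightarrow> P i) \<longrightarrow> P (2 * m)) \<and>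
          (odd k \<longrightarrow> (\<forall>i. odd i \<and> 1 \<le> i \<and> i \<le> k - 2 \<longrightarrow> P i) \<longrightarrow> \<not> P k)) \<longleftrightarrow> coupled k P" for P
    by (auto simp: coupled_def)
  have "f \<in> coupled_multicolorings k C \<longleftrightarrow> f \<in> (\<Pi>\<^sub>E i\<in>{1..k}. V \<rightarrow>\<^sub>E C i) \<and>
      (\<forall>a b. {a, b} \<in> E \<longrightarrow> coupled k (\<lambda>i. f i a = f i b))" for f
    unfolding coupled_multicolorings_def mem_Collect_eq
    by (simp only: c[of "\<lambda>i. f i a = f i b" for f :: "nat \<Rightarrow> 'v \<Rightarrow> 'c" and a b])
  moreover have "(\<forall>a b. {a, b} \<in> E \<longrightarrow> coupled k (\<lambda>i. f i a = f i b)) \<longleftrightarrow>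
      (\<forall>e\<in>E. coupled k (\<lambda>i. \<forall>a\<in>e. \<forall>b\<in>e. f i a = f i b))" for f :: "nat \<Rightarrow> 'v \<Rightarrow> 'c"
  proof -
    have eq: "(\<forall>x\<in>{a, b}. \<forall>y\<in>{a, b}. f i x = f i y) \<longleftrightarrow> f i a = f i b" for i a b by auto
    show ?thesis
    proof (intro iffI ballI allI impI)
      fix e assume L: "\<forall>a b. {a, b} \<in> E \<longrightarrow> coupled k (\<lambda>i. f i a = f i b)" and e: "e \<in> E"
      obtain a b where ab: "e = {a, b}" using e by (rule edge_doubleton)
      show "coupled k (\<lambda>i. \<forall>a\<in>e. \<forall>b\<in>e. f i a = f i b)"
        unfolding ab eq using L e[unfolded ab] by blast
    next
      fix a b assume "\<forall>e\<in>E. coupled k (\<lambda>i. \<forall>a\<in>e. \<forall>b\<in>e. f i a = f i b)" "{a, b} \<in> E"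
      then have "coupled k (\<lambda>i. \<forall>x\<in>{a, b}. \<forall>y\<in>{a, b}. f i x = f i y)" by (rule bspec)
      then show "coupled k (\<lambda>i. f i a = f i b)" unfolding eq .
    qed
  qed
  ultimately show ?thesis by (intro set_eqI) (simp only: mem_Collect_eq)
qed

lemma num_coupled_multicolorings_eq_char_poly:
  fixes C :: "nat \<Rightarrow> 'c set"
  assumes fin: "\<And>i. i \<in> {1..k} \<Longrightarrow> finite (C i)"
  shows "int (num_coupled_multicolorings k C) =
    (\<Prod>i=1..k. int (card (C i))) ^ num_components E *
      graphic.char_poly k (\<lambda>i. int (card (C (k + 1 - i))))"
proof -
  define mono :: "'v set \<Rightarrow> ('v \<Rightarrow> 'c) \<Rightarrow> bool"
    where "mono e f \<longleftrightarrow> (\<forall>a\<in>e. \<forall>b\<in>e. f a = f b)" for e f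
  let ?F = "\<lambda>i. V \<rightarrow>\<^sub>E C i"
  let ?M = "\<Pi>\<^sub>E i\<in>{1..k}. ?F i"
  have finF: "finite (?F i)" if "i \<in> {1..k}" for i
    using fin[OF that] finite_V by (intro finite_PiE)
  have finM: "finite ?M"
    by (intro finite_PiE finF) auto
  have count: "(\<Sum>f\<in>?F i. \<Prod>e\<in>A. - of_bool (mono e f)) =
      (- 1) ^ card A * int (card (C i)) ^ num_components A"
    if "A \<subseteq> E" "i \<in> {1..k}" for A i
  proof -
    have "finite A" using that(1) finite_E by (rule finite_subset)
    then have "(\<Prod>e\<in>A. - of_bool (mono e f)) = ((- 1) ^ card A * of_bool (\<forall>e\<in>A. mono e f) :: int)"
      for f :: "'v \<Rightarrow> 'c"
      by (simp add: prod_uminus prod_of_bool)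
    then have "(\<Sum>f\<in>?F i. \<Prod>e\<in>A. - of_bool (mono e f)) =
        (- 1) ^ card A * (\<Sum>f\<in>?F i. of_bool (\<forall>e\<in>A. mono e f) :: int)"
      by (simp add: sum_distrib_left)
    also have "(\<Sum>f\<in>?F i. of_bool (\<forall>e\<in>A. mono e f) :: int) =
        int (card {f \<in> ?F i. \<forall>e\<in>A. mono e f})"
      using finF[OF that(2)] by (simp add: Int_def)
    finally show ?thesis
      by (simp add: mono_def num_edgewise_constant[OF that(1)])
  qed
  \<comment> \<open>Splits the exponent of each number of colours into the common part
    \<open>num_components E\<close>, which is pulled out in the end, and the exponent in
    \<open>char_poly\<close>.\<close>
  have expand: "num_components A = num_components E + (rk E - rk A)" if "A \<subseteq> E" for A
    using graphic.rank_mono[OF that] rk_plus_num_components[of A] rk_plus_num_components[of E]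
    by simp
  have "int (num_coupled_multicolorings k C) =
      (\<Sum>f\<in>?M. of_bool (\<forall>e\<in>E. coupled k (\<lambda>i. mono e (f i))))"
    using finM
    by (simp add: num_coupled_multicolorings_def coupled_multicolorings_eq mono_def Int_def)
  also have "\<dots> = (\<Sum>f\<in>?M. \<Prod>e\<in>E. of_bool (coupled k (\<lambda>i. mono e (f i))))"
    by (simp only: prod_of_bool[OF finite_E])
  also have "\<dots> = (\<Sum>f\<in>?M. \<Prod>e\<in>E. \<Sum>j\<le>k. \<Prod>i\<in>{j<..k}. - of_bool (mono e (f (k + 1 - i))))"
    by (simp only: of_bool_coupled sum_prod_rev_eq[symmetric])
  also have "\<dots> = (\<Sum>f\<in>?M. \<Sum>A\<in>subset_chains k E. \<Prod>i=1..k. \<Prod>e\<in>A i.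
      - of_bool (mono e (f (k + 1 - i))))"
    by (subst sum_subset_chains[OF finite_E]) simp
  also have "\<dots> = (\<Sum>A\<in>subset_chains k E. \<Sum>f\<in>?M. \<Prod>i=1..k. \<Prod>e\<in>A i.
      - of_bool (mono e (f (k + 1 - i))))"
    by (rule sum.swap)
  \<comment> \<open>The reversal moves from the colourings to the chain, so that the factor for
    \<open>i\<close> involves \<open>f i\<close> alone and the sum over tuples splits by
    \<open>prod_sum_PiE\<close>. Afterwards it is moved back.\<close>
  also have "\<dots> = (\<Sum>A\<in>subset_chains k E. \<Sum>f\<in>?M. \<Prod>i=1..k. \<Prod>e\<in>A (k + 1 - i).
      - of_bool (mono e (f i)))"
    by (intro sum.cong refl prod.reindex_bij_witness
      [where i = "\<lambda>i. k + 1 - i" and j = "\<lambda>i. k + 1 - i"]) auto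
  also have "\<dots> = (\<Sum>A\<in>subset_chains k E. \<Prod>i=1..k. \<Sum>f\<in>?F i. \<Prod>e\<in>A (k + 1 - i).
      - of_bool (mono e f))"
    by (intro sum.cong refl prod_sum_PiE[symmetric] finF) auto
  also have "\<dots> = (\<Sum>A\<in>subset_chains k E. \<Prod>i=1..k. \<Sum>f\<in>?F (k + 1 - i). \<Prod>e\<in>A i.
      - of_bool (mono e f))"
    by (intro sum.cong refl prod.reindex_bij_witness
      [where i = "\<lambda>i. k + 1 - i" and j = "\<lambda>i. k + 1 - i"]) auto
  also have "\<dots> = (\<Sum>A\<in>subset_chains k E. \<Prod>i=1..k.
      int (card (C (k + 1 - i))) ^ num_components E *
      ((- 1) ^ card (A i) * int (card (C (k + 1 - i))) ^ (rk E - rk (A i))))"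
  proof (intro sum.cong prod.cong refl)
    fix A i assume "A \<in> subset_chains k E" and i: "i \<in> {1..k}"
    then have "A i \<subseteq> E" by (auto simp: subset_chains_def)
    then show "(\<Sum>f\<in>?F (k + 1 - i). \<Prod>e\<in>A i. - of_bool (mono e f)) =
        int (card (C (k + 1 - i))) ^ num_components E *
        ((- 1) ^ card (A i) * int (card (C (k + 1 - i))) ^ (rk E - rk (A i)))"
      using i by (subst count) (auto simp: expand[of "A i"] power_add)
  qed
  also have "\<dots> = (\<Prod>i=1..k. int (card (C (k + 1 - i)))) ^ num_components E *
      graphic.char_poly k (\<lambda>i. int (card (C (k + 1 - i))))"
    by (simp add: prod.distrib prod_power_distrib sum_distrib_left graphic.char_poly_def
        chains_eq_subset_chains)
  also have "(\<Prod>i=1..k. int (card (C (k + 1 - i)))) = (\<Prod>i=1..k. int (card (C i)))"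
    by (intro prod.reindex_bij_witness[where i = "\<lambda>i. k + 1 - i" and j = "\<lambda>i. k + 1 - i"]) auto
  finally show ?thesis .
qed

end

section \<open>From the characteristic to the Tutte polynomial\<close>

text \<open>The summands agree chain by chain and factor by factor, up to a sign
  \<open>(- 1) ^ r S\<close> for each of the \<open>k\<close> indices.\<close>

lemma (in matroid) char_poly_eq_tutte_poly:
  fixes t :: "nat \<Rightarrow> 'b::comm_ring_1"
  shows "char_poly k t = (- 1) ^ (k * r S) * tutte_poly k (\<lambda>i. 1 - t i) (\<lambda>_. 0)"
proof -
  have "(- 1) ^ r S * ((1 - t i - 1) ^ (r S - r X) * (0 - 1) ^ (card X - r X)) =
      (- 1) ^ card X * t i ^ (r S - r X)" if "X \<subseteq> S" for X i
  proof -
    \<comment> \<open>Neither subtraction truncates, so the sum is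
      \<open>2 * r S - 2 * r X + card X\<close>.\<close>
    have "even (r S + (r S - r X) + (card X - r X)) \<longleftrightarrow> even (card X)"
      using rank_le_card[OF that] rank_mono[OF that subset_refl] by auto
    then have "(- 1 :: 'b) ^ (r S + (r S - r X) + (card X - r X)) = (- 1) ^ card X"
      by (simp add: minus_one_power_iff)
    moreover have "(- 1) ^ r S * ((1 - t i - 1) ^ (r S - r X) * (0 - 1) ^ (card X - r X)) =
        (- 1) ^ (r S + (r S - r X) + (card X - r X)) * t i ^ (r S - r X)"
      by (simp add: power_minus[of "t i"] power_add mult_ac)
    ultimately show ?thesis by simp
  qed
  then have "(\<Prod>i=1..k. (- 1) ^ card (A i) * t i ^ (r S - r (A i))) =
      (\<Prod>i=1..k. (- 1) ^ r S *
        ((1 - t i - 1) ^ (r S - r (A i)) * (0 - 1) ^ (card (A i) - r (A i))))"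
    if "A \<in> chains k" for A
    using that by (intro prod.cong refl) (auto simp: chains_def PiE_iff)
  then show ?thesis
    by (simp add: char_poly_def tutte_poly_def prod.distrib sum_distrib_left
        power_mult[symmetric] mult.commute[of k])
qed

theorem theorem1p10:
  fixes V :: "'v set" and E :: "'v set set" and k :: nat
    and t :: "nat \<Rightarrow> nat" and C :: "nat \<Rightarrow> 'c set"
  assumes "simple_graph V E"
    and "k > 0"
    and "\<And>i. i \<in> {1..k} \<Longrightarrow> t i > 0"
    and "\<And>i. i \<in> {1..k} \<Longrightarrow> finite (C i) \<and> card (C i) = t i"
  shows "int (simple_graph.num_coupled_multicolorings V E k C) =
      (\<Prod>i=1..k. int (t i)) ^ simple_graph.num_components V E *
      matroid.char_poly E (simple_graph.rk V) k (\<lambda>i. int (t (k + 1 - i)))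
    \<and> (\<Prod>i=1..k. int (t i)) ^ simple_graph.num_components V E *
      matroid.char_poly E (simple_graph.rk V) k (\<lambda>i. int (t (k + 1 - i))) =
      (- 1) ^ (k * simple_graph.rk V E) *
      (\<Prod>i=1..k. int (t i)) ^ simple_graph.num_components V E *
      matroid.tutte_poly E (simple_graph.rk V) k (\<lambda>i. 1 - int (t (k + 1 - i))) (\<lambda>_. 0)"
proof -
  interpret simple_graph V E by fact
  have "card (C (k + 1 - i)) = t (k + 1 - i)" if "i \<in> {1..k}" for i
    using that by (intro assms(4)[THEN conjunct2]) auto
  then have "graphic.char_poly k (\<lambda>i. int (card (C (k + 1 - i)))) =
      graphic.char_poly k (\<lambda>i. int (t (k + 1 - i)))"
    unfolding graphic.char_poly_def by (intro sum.cong prod.cong) auto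
  moreover have "(\<Prod>i=1..k. int (card (C i))) = (\<Prod>i=1..k. int (t i))"
    using assms(4) by (intro prod.cong) auto
  ultimately have "int (num_coupled_multicolorings k C) =
      (\<Prod>i=1..k. int (t i)) ^ num_components E * graphic.char_poly k (\<lambda>i. int (t (k + 1 - i)))"
    using num_coupled_multicolorings_eq_char_poly[of k C] assms(4) by simp
  then show ?thesis
    by (simp add: graphic.char_poly_eq_tutte_poly)
qed

end
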